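(* Let $q$ be a prime power, let $T=\mathrm{PSL}(2,q)$, and let $G=T\times T$ act on $\Omega=T$ in its diagonal action, $t^{(x,y)}=x^{-1}ty$. Then $G$ is non-spreading on $\Omega$.
   Context: For a set or multiset $A$ with elements in a finite set $\Omega$, the characteristic vector $\chi_A$ is the vector indexed by $\Omega$ whose entry at $\alpha$ is the multiplicity (a non-negative integer) of $\alpha$ in $A$; $|A|=|\chi_A|$ denotes the sum of the entries of $\chi_A$. A multiset (or set) is nontrivial if its characteristic vector is nonconstant and more than one element has nonzero multiplicity. The symbol $\circ$ denotes the Schur (entrywise) product of vectors. A transitive group $G$ acting on a finite set $\Omega$ is non-spreading if there exist a nontrivial multiset $A$ of elements of $\Omega$, a nontrivial set $B\subseteq\Omega$, and a positive integer $\lambda$ such that $|A|$ divides $|\Omega|$ and $|\chi_A\circ\chi_{B^g}|=\lambda$ for all $g\in G$. For a group $T$, the diagonal action of $T\times T$ on $T$ is given by $t^{(x,y)}:=x^{-1}ty$. *)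

theory Defs
  imports
    "HOL-Analysis.Determinants"
    "HOL-Algebra.Group_Action"
    "HOL-Library.Multiset"
    "HOL-Library.Indicator_Function"
    "HOL-Number_Theory.Prime_Powers"
begin

section \<open>Characteristic vectors\<close>

text \<open>A vector indexed by a finite set \<open>\<Omega>\<close> is a function of type \<open>'a \<Rightarrow> nat\<close>, of which only the
  values on \<open>\<Omega>\<close> matter. The characteristic vector of a multiset \<open>A\<close> is \<open>count A\<close>; that of a set
  \<open>B\<close> is its indicator function.\<close>

abbreviation char_mset :: "'a multiset \<Rightarrow> 'a \<Rightarrow> nat" where
  "char_mset A \<equiv> count A"

abbreviation char_set :: "'a set \<Rightarrow> 'a \<Rightarrow> nat" where
  "char_set B \<equiv> indicator B"

definition schur :: "('a \<Rightarrow> nat) \<Rightarrow> ('a \<Rightarrow> nat) \<Rightarrow> 'a \<Rightarrow> nat" where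
  "schur v w = (\<lambda>\<alpha>. v \<alpha> * w \<alpha>)"

definition entry_sum :: "'a set \<Rightarrow> ('a \<Rightarrow> nat) \<Rightarrow> nat" where
  "entry_sum \<Omega> v = (\<Sum>\<alpha>\<in>\<Omega>. v \<alpha>)"

definition nontrivial :: "'a set \<Rightarrow> ('a \<Rightarrow> nat) \<Rightarrow> bool" where
  "nontrivial \<Omega> v \<longleftrightarrow> \<not> (\<exists>c. \<forall>\<alpha>\<in>\<Omega>. v \<alpha> = c) \<and> card {\<alpha> \<in> \<Omega>. v \<alpha> \<noteq> 0} > 1"

section \<open>Non-spreading actions\<close>

text \<open>Actions are written exponentially and are right actions, whereas
  \<open>group_action\<close> in the library is a left action by extensional bijections; the two are related by
  inversion, see \<open>transitive_action_inv\<close> below.\<close>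

locale transitive_right_action = group G for G (structure) +
  fixes \<Omega> :: "'b set" and act :: "'b \<Rightarrow> 'a \<Rightarrow> 'b"
  assumes act_closed: "\<lbrakk>\<alpha> \<in> \<Omega>; g \<in> carrier G\<rbrakk> \<Longrightarrow> act \<alpha> g \<in> \<Omega>"
    and act_one: "\<alpha> \<in> \<Omega> \<Longrightarrow> act \<alpha> \<one> = \<alpha>"
    and act_mult: "\<lbrakk>\<alpha> \<in> \<Omega>; g \<in> carrier G; h \<in> carrier G\<rbrakk> \<Longrightarrow> act \<alpha> (g \<otimes> h) = act (act \<alpha> g) h"
    and transitive: "\<lbrakk>\<alpha> \<in> \<Omega>; \<beta> \<in> \<Omega>\<rbrakk> \<Longrightarrow> \<exists>g\<in>carrier G. act \<alpha> g = \<beta>"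

lemma (in transitive_right_action) transitive_action_inv:
  "transitive_action G \<Omega> (\<lambda>g. \<lambda>\<alpha>\<in>\<Omega>. act \<alpha> (inv g))"
proof -
  have b: "bij_betw (\<lambda>\<alpha>. act \<alpha> (inv g)) \<Omega> \<Omega>" if g: "g \<in> carrier G" for g
    by (rule bij_betw_byWitness[where f' = "\<lambda>\<alpha>. act \<alpha> g"])
      (use g in \<open>auto simp: act_closed act_one simp flip: act_mult\<close>)
  show ?thesis
  proof (intro_locales)
    show "transitive_action_axioms G \<Omega> (\<lambda>g. \<lambda>\<alpha>\<in>\<Omega>. act \<alpha> (inv g))"
    proof
      fix x y assume "x \<in> \<Omega>" "y \<in> \<Omega>"
      with transitive obtain g where "g \<in> carrier G" "act x g = y" by blast
      then show "\<exists>g\<in>carrier G. (\<lambda>\<alpha>\<in>\<Omega>. act \<alpha> (inv g)) x = y"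
        using \<open>x \<in> \<Omega>\<close> by (intro bexI[of _ "inv g"]) auto
    qed
    have e: "(\<lambda>\<alpha>\<in>\<Omega>. act \<alpha> (inv g)) \<in> Bij \<Omega>" if "g \<in> carrier G" for g
      using b[OF that] by (simp add: Bij_def cong: bij_betw_cong)
    show "group_action G \<Omega> (\<lambda>g. \<lambda>\<alpha>\<in>\<Omega>. act \<alpha> (inv g))"
      unfolding group_action_def group_hom_def group_hom_axioms_def hom_def
      using e group_BijGroup[of \<Omega>] is_group
      by (auto simp: BijGroup_def compose_def fun_eq_iff inv_mult_group act_mult act_closed)
  qed
qed

definition non_spreading ::
    "('a, 'm) monoid_scheme \<Rightarrow> 'b set \<Rightarrow> ('b \<Rightarrow> 'a \<Rightarrow> 'b) \<Rightarrow> bool" where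
  "non_spreading G \<Omega> act \<longleftrightarrow>
     finite \<Omega> \<and> transitive_right_action G \<Omega> act \<and>
     (\<exists>(A :: 'b multiset) (B :: 'b set) (l :: nat).
        set_mset A \<subseteq> \<Omega> \<and> nontrivial \<Omega> (char_mset A) \<and>
        B \<subseteq> \<Omega> \<and> nontrivial \<Omega> (char_set B) \<and>
        l > 0 \<and>
        entry_sum \<Omega> (char_mset A) dvd card \<Omega> \<and>
        (\<forall>g\<in>carrier G.
           entry_sum \<Omega> (schur (char_mset A) (char_set ((\<lambda>\<beta>. act \<beta> g) ` B))) = l))"

definition diagonal_action ::
    "('a, 'm) monoid_scheme \<Rightarrow> 'a \<Rightarrow> 'a \<times> 'a \<Rightarrow> 'a" where
  "diagonal_action T t = (\<lambda>(x, y). inv\<^bsub>T\<^esub> x \<otimes>\<^bsub>T\<^esub> t \<otimes>\<^bsub>T\<^esub> y)"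

section \<open>Projective special linear groups\<close>

definition SL :: "('k::field ^ 'n ^ 'n) monoid" where
  "SL = \<lparr>carrier = {M. det M = 1}, mult = (**), one = mat 1\<rparr>"

text \<open>The scalar matrices of determinant 1; \<open>mat c\<close> is the diagonal matrix with all diagonal
  entries \<open>c\<close>.\<close>

definition SL_scalars :: "('k::field ^ 'n ^ 'n) set" where
  "SL_scalars = {M. det M = 1 \<and> (\<exists>c. M = mat c)}"

definition PSL :: "('k::field ^ 'n ^ 'n) set monoid" where
  "PSL = SL Mod SL_scalars"

lemma group_SL: "group (SL :: ('k::field ^ 'n ^ 'n) monoid)"
proof (rule groupI)
  fix M :: "'k^'n^'n" assume "M \<in> carrier SL"
  then have d: "det M = 1" by (simp add: SL_def)
  then have "invertible M" by (simp add: invertible_det_nz)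
  then obtain N where N: "N ** M = mat 1" by (auto simp: invertible_def)
  with d have "det N = 1" by (metis det_mul det_I mult.right_neutral)
  with N show "\<exists>N\<in>carrier SL. N \<otimes>\<^bsub>SL\<^esub> M = \<one>\<^bsub>SL\<^esub>" by (auto simp: SL_def)
qed (auto simp: SL_def det_mul matrix_mul_assoc)

lemma mat_mult: "mat c ** M = (\<chi> i j. c * M $ i $ j)" "M ** mat c = (\<chi> i j. M $ i $ j * c)"
  for M :: "'k::field ^ 'n ^ 'n"
  by (simp_all add: matrix_matrix_mult_def mat_def vec_eq_iff if_distrib if_distribR
      sum.delta sum.delta' cong: if_cong)

lemma mat_commute: "mat c ** M = M ** mat c" for M :: "'k::field ^ 'n ^ 'n"
  by (simp add: mat_mult mult.commute)

lemma normal_SL_scalars: "(SL_scalars :: ('k::field ^ 'n ^ 'n) set) \<lhd> SL"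
proof -
  interpret group "SL :: ('k ^ 'n ^ 'n) monoid" by (rule group_SL)
  have mm: "mat a ** mat b = (mat (a * b) :: 'k^'n^'n)" for a b
    by (simp add: mat_mult) (simp add: mat_def vec_eq_iff)
  have sub: "subgroup (SL_scalars :: ('k ^ 'n ^ 'n) set) SL"
  proof (rule subgroupI)
    fix M :: "'k^'n^'n" assume M: "M \<in> SL_scalars"
    then obtain c where c: "M = mat c" and d: "det M = 1" by (auto simp: SL_scalars_def)
    have "invertible M" using d by (simp add: invertible_det_nz)
    then obtain N where N: "M ** N = mat 1" by (auto simp: invertible_def)
    have "c \<noteq> 0"
    proof
      assume "c = 0"
      with N c have "(mat 0 ** N) $ i $ i = (mat 1 :: 'k^'n^'n) $ i $ i" for i by simp
      then show False by (simp add: mat_mult(1)) (simp add: mat_def)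
    qed
    then have e: "mat (inverse c) ** M = mat 1" using c by (simp add: mm)
    then have "det (mat (inverse c) :: 'k^'n^'n) = 1"
      using d by (metis det_mul det_I mult.right_neutral)
    moreover from this e d have "inv\<^bsub>SL\<^esub> M = mat (inverse c)"
      by (intro inv_equality) (auto simp: SL_def)
    ultimately show "inv\<^bsub>SL\<^esub> M \<in> SL_scalars" by (auto simp: SL_scalars_def)
  next
    have "(mat 1 :: 'k^'n^'n) \<in> SL_scalars" by (auto simp: SL_scalars_def)
    then show "(SL_scalars :: ('k ^ 'n ^ 'n) set) \<noteq> {}" by blast
  qed (auto simp: SL_scalars_def SL_def mm det_mul)
  have "M \<otimes>\<^bsub>SL\<^esub> N \<otimes>\<^bsub>SL\<^esub> inv\<^bsub>SL\<^esub> M \<in> SL_scalars"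
    if M: "M \<in> carrier SL" and N: "N \<in> SL_scalars" for M N :: "'k^'n^'n"
  proof -
    have Nc: "N \<in> carrier SL" using N by (simp add: SL_def SL_scalars_def)
    have "M \<otimes>\<^bsub>SL\<^esub> N = N \<otimes>\<^bsub>SL\<^esub> M"
      using N by (auto simp: SL_scalars_def SL_def mat_commute)
    then have "M \<otimes>\<^bsub>SL\<^esub> N \<otimes>\<^bsub>SL\<^esub> inv\<^bsub>SL\<^esub> M = N"
      using M Nc by (simp add: m_assoc)
    then show ?thesis using N by simp
  qed
  with sub show ?thesis by (simp add: normal_inv_iff)
qed

lemma group_PSL: "group (PSL :: ('k::field ^ 'n ^ 'n) set monoid)"
  unfolding PSL_def by (rule normal.factorgroup_is_group[OF normal_SL_scalars])

end

theory Submission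
  imports Defs
begin

text \<open>Take for \<open>B\<close> the image of the Borel subgroup of upper triangular matrices, and for \<open>A\<close> a class
  function of total weight \<open>|T|\<close> that has the same sum over every translate of \<open>B\<close>. Such a class
  function is \<open>1 + \<phi>(tr M) + q [M scalar]\<close>: over the translate by \<open>g\<close> of the Borel subgroup of
  \<open>SL(2,q)\<close>, the function \<open>\<phi>(tr M)\<close> sums to a multiple of \<open>\<Sum>\<^sub>s \<phi>(s)\<close> if \<open>g\<close> is not upper triangular,
  and to \<open>q \<Sum>\<^sub>a \<phi>(a + a\<inverse>)\<close> otherwise; only in the latter case does the translate contain scalars.
  So it suffices that \<open>\<phi>\<close> is even, at least \<open>-1\<close>, sums to \<open>0\<close>, and that its values at the traces
  \<open>a + a\<inverse>\<close> sum to minus the number of scalars. Since \<open>a + a\<inverse>\<close> takes at most \<open>q - 1\<close> values, some \<open>t\<close>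
  is missed, and \<open>\<phi>\<close> can be supported on \<open>\<plusminus>2\<close> (with value \<open>-1\<close>) and \<open>\<plusminus>t\<close>.\<close>

section \<open>Sums over cosets and diagonal actions of quotient groups\<close>

text \<open>The closure condition makes \<open>S\<close> a disjoint union of cosets of
  \<open>N\<close>, each of size \<open>card N\<close>, and the summand is constant on each. This
  moves sums between a quotient and the group above it.\<close>

lemma (in group) sum_rcosets:
  fixes h :: "'a set \<Rightarrow> nat"
  assumes "subgroup N G" and fin: "finite (carrier G)" and S: "S \<subseteq> carrier G"
    and closed: "\<And>n s. \<lbrakk>n \<in> N; s \<in> S\<rbrakk> \<Longrightarrow> n \<otimes> s \<in> S"
  shows "(\<Sum>s\<in>S. h (N #> s)) = card N * (\<Sum>C\<in>(#>) N ` S. h C)"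
proof -
  interpret N: subgroup N G by fact
  have finS: "finite S" using S fin finite_subset by blast
  have fiber: "{s \<in> S. N #> s = C} = C \<and> card C = card N" if C: "C \<in> (#>) N ` S" for C
  proof -
    obtain s where s: "s \<in> S" "C = N #> s" using C by auto
    have "C \<subseteq> S" using s closed by (auto simp: r_coset_def)
    moreover have "N #> u = C" if "u \<in> C" for u
      using repr_independence[of u N s] that s S assms(1) by auto
    moreover have "u \<in> N #> u" if "u \<in> S" for u
      using rcos_self[of u N] that S assms(1) by auto
    moreover have "card C = card N"
      using card_rcosets_equal[OF rcosetsI[OF N.subset] N.subset, of s] s S by auto
    ultimately show ?thesis by auto
  qed
  have "(\<Sum>s\<in>S. h (N #> s)) = (\<Sum>C\<in>(#>) N ` S. \<Sum>s\<in>{s \<in> S. N #> s = C}. h (N #> s))"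
    by (rule sum.image_gen[OF finS])
  also have "\<dots> = (\<Sum>C\<in>(#>) N ` S. card N * h C)"
  proof (rule sum.cong[OF refl])
    fix C assume "C \<in> (#>) N ` S"
    then have f: "{s \<in> S. N #> s = C} = C" "card C = card N" using fiber by auto
    have "(\<Sum>s\<in>{s \<in> S. N #> s = C}. h (N #> s)) = (\<Sum>s\<in>{s \<in> S. N #> s = C}. h C)"
      by (rule sum.cong) auto
    then show "(\<Sum>s\<in>{s \<in> S. N #> s = C}. h (N #> s)) = card N * h C"
      by (simp add: f)
  qed
  finally show ?thesis by (simp add: sum_distrib_left)
qed

lemma transitive_right_action_diagonal:
  assumes "group T"
  shows "transitive_right_action (T \<times>\<times> T) (carrier T) (diagonal_action T)"
proof -
  interpret group T by fact
  interpret TT: group "T \<times>\<times> T" by (rule DirProd_group) (rule assms)+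
  show ?thesis
  proof
    fix s t assume st: "s \<in> carrier T" "t \<in> carrier T"
    then have "diagonal_action T s (\<one>\<^bsub>T\<^esub>, inv\<^bsub>T\<^esub> s \<otimes>\<^bsub>T\<^esub> t) = t"
      by (simp add: diagonal_action_def flip: m_assoc)
    with st show "\<exists>g\<in>carrier (T \<times>\<times> T). diagonal_action T s g = t"
      by (intro bexI[of _ "(\<one>\<^bsub>T\<^esub>, inv\<^bsub>T\<^esub> s \<otimes>\<^bsub>T\<^esub> t)"]) auto
  qed (auto simp: diagonal_action_def inv_mult_group m_assoc)
qed

text \<open>Lifts the problem from the quotient to \<open>G\<close>: \<open>f\<close> descends to
  the multiplicities of \<open>A\<close>, and \<open>H\<close> maps onto \<open>B\<close>. A
  translate of \<open>B\<close> lifts to \<open>inv a H b\<close>, and because \<open>f\<close> is a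
  class function only the right translates \<open>H g\<close> have to be averaged. The elements
  \<open>x\<close>, \<open>\<one>\<close> and \<open>y\<close> witness that \<open>A\<close> is
  nontrivial.\<close>

lemma (in group) non_spreading_diagonal_Mod:
  fixes f :: "'a \<Rightarrow> nat"
  assumes N: "N \<lhd> G" and fin: "finite (carrier G)"
    and H: "subgroup H G" "N \<subseteq> H" "H \<noteq> carrier G" "H \<noteq> N"
    and central: "\<And>x y. \<lbrakk>x \<in> carrier G; y \<in> carrier G\<rbrakk> \<Longrightarrow> f (x \<otimes> y) = f (y \<otimes> x)"
    and invariant: "\<And>n x. \<lbrakk>n \<in> N; x \<in> carrier G\<rbrakk> \<Longrightarrow> f (n \<otimes> x) = f x"
    and average: "\<And>g. g \<in> carrier G \<Longrightarrow> (\<Sum>h\<in>H. f (h \<otimes> g)) = card H"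
    and zero: "x \<in> carrier G" "f x = 0"
    and one: "f \<one> \<noteq> 0"
    and other: "y \<in> carrier G" "y \<notin> N" "f y \<noteq> 0"
  shows "non_spreading ((G Mod N) \<times>\<times> (G Mod N)) (carrier (G Mod N)) (diagonal_action (G Mod N))"
proof -
  interpret N: normal N G by fact
  interpret H: subgroup H G by fact
  interpret Q: group "G Mod N" by (rule N.factorgroup_is_group)
  have sub: "subgroup N G" by (rule N.subgroup_axioms)
  have finH: "finite H" using fin H.subset finite_subset by blast
  have finN: "card N > 0" using fin N.subset finite_subset N.one_closed by (metis card_gt_0_iff empty_iff)
  have carQ: "carrier (G Mod N) = (#>) N ` carrier G"
    by (auto simp: FactGroup_def RCOSETS_def)
  have finQ: "finite (carrier (G Mod N))" using fin carQ by simp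
  have coset_eq: "N #> u = N #> v \<longleftrightarrow> u \<otimes> inv v \<in> N" if "u \<in> carrier G" "v \<in> carrier G" for u v
    using that by (metis N.rcos_module rcos_self repr_independence group_axioms sub)
  \<comment> \<open>The choice of representative is harmless, since \<open>f\<close> is constant on
    cosets of \<open>N\<close>.\<close>
  define w where "w C = f (SOME u. u \<in> C)" for C
  have w: "w (N #> u) = f u" if u: "u \<in> carrier G" for u
  proof -
    have "(SOME v. v \<in> N #> u) \<in> N #> u" by (rule someI) (rule rcos_self[OF u sub])
    then obtain n where "n \<in> N" "(SOME v. v \<in> N #> u) = n \<otimes> u" by (auto simp: r_coset_def)
    then show ?thesis using invariant u by (simp add: w_def)
  qed
  define A where "A = Abs_multiset (\<lambda>C. if C \<in> carrier (G Mod N) then w C else 0)"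
  have countA: "count A = (\<lambda>C. if C \<in> carrier (G Mod N) then w C else 0)"
    unfolding A_def by (rule count_Abs_multiset) (rule finite_subset[OF _ finQ], auto split: if_splits)
  define B where "B = (#>) N ` H"
  have BQ: "B \<subseteq> carrier (G Mod N)" using H.subset by (auto simp: B_def carQ)
  have memB: "N #> u \<in> B \<longleftrightarrow> u \<in> H" if u: "u \<in> carrier G" for u
  proof
    assume "N #> u \<in> B"
    then obtain h where h: "h \<in> H" "N #> u = N #> h" by (auto simp: B_def)
    then have "u \<otimes> inv h \<in> H" using coset_eq u H(2) H.mem_carrier by blast
    then have "u \<otimes> inv h \<otimes> h \<in> H" using h by blast
    then show "u \<in> H" using u h by (simp add: m_assoc)
  qed (simp add: B_def)
  have sumQ: "card N * (\<Sum>C\<in>(#>) N ` S. w C) = (\<Sum>s\<in>S. f s)"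
    if "S \<subseteq> carrier G" "\<And>n s. \<lbrakk>n \<in> N; s \<in> S\<rbrakk> \<Longrightarrow> n \<otimes> s \<in> S" for S
    using sum_rcosets[OF sub fin that, of w] that(1) by (simp add: w subset_iff)
  \<comment> \<open>Averaging over all translates of \<open>H\<close>.\<close>
  have total: "(\<Sum>u\<in>carrier G. f u) = card (carrier G)"
  proof -
    have "card H * (\<Sum>u\<in>carrier G. f u) = (\<Sum>h\<in>H. \<Sum>g\<in>carrier G. f (h \<otimes> g))"
    proof -
      have "(\<Sum>g\<in>carrier G. f (h \<otimes> g)) = (\<Sum>u\<in>carrier G. f u)" if "h \<in> H" for h
        using that H.subset
        by (intro sum.reindex_bij_witness[where i = "\<lambda>u. inv h \<otimes> u" and j = "\<lambda>u. h \<otimes> u"])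
          (auto simp flip: m_assoc)
      then show ?thesis by simp
    qed
    also have "\<dots> = card H * card (carrier G)"
      by (subst sum.swap) (simp add: average)
    finally show ?thesis using finH H.one_closed by (metis card_gt_0_iff empty_iff
          less_numeral_extra(3) mult_left_cancel)
  qed
  have totalQ: "entry_sum (carrier (G Mod N)) (count A) = card (carrier (G Mod N))"
  proof -
    have "card N * (\<Sum>C\<in>carrier (G Mod N). w C) = card (carrier G)"
      unfolding carQ by (subst sumQ) (auto simp: total)
    also have "\<dots> = card N * card (carrier (G Mod N))"
      using sum_rcosets[OF sub fin order_refl, of "\<lambda>_. 1"] unfolding carQ by simp
    finally show ?thesis using finN by (simp add: entry_sum_def countA)
  qed
  have slice: "card N * entry_sum (carrier (G Mod N))
      (schur (count A) (indicator ((\<lambda>\<beta>. diagonal_action (G Mod N) \<beta> g) ` B))) = card H"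
    if g: "g \<in> carrier ((G Mod N) \<times>\<times> (G Mod N))" for g
  proof -
    obtain a b where ab: "a \<in> carrier G" "b \<in> carrier G" "g = (N #> a, N #> b)"
      using g by (auto simp: carQ)
    \<comment> \<open>\<open>S\<close> is the lift to \<open>G\<close> of the translate of
      \<open>B\<close> by \<open>g\<close>. It is a union of cosets of \<open>N\<close>: a left
      factor \<open>n\<close> passes through \<open>inv a\<close> as a conjugate, which lies in
      \<open>N\<close> and hence in \<open>H\<close>.\<close>
    define S where "S = (\<lambda>h. inv a \<otimes> h \<otimes> b) ` H"
    have S: "S \<subseteq> carrier G" using ab H.subset by (auto simp: S_def)
    have Sclosed: "n \<otimes> s \<in> S" if "n \<in> N" "s \<in> S" for n s
    proof -
      obtain h where h: "h \<in> H" "s = inv a \<otimes> h \<otimes> b" using \<open>s \<in> S\<close> by (auto simp: S_def)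
      have n: "n \<in> carrier G" using that by (simp add: N.mem_carrier)
      have "a \<otimes> n \<otimes> inv a \<in> H" using N.inv_op_closed2[of a n] ab that H(2) by auto
      then have "a \<otimes> n \<otimes> inv a \<otimes> h \<in> H" using h by blast
      moreover have "n \<otimes> s = inv a \<otimes> (a \<otimes> n \<otimes> inv a \<otimes> h) \<otimes> b"
        using ab h n H.mem_carrier[OF h(1)] by (simp add: m_assoc inv_solve_left)
      ultimately show ?thesis by (auto simp: S_def)
    qed
    have inj: "inj_on (\<lambda>h. inv a \<otimes> h \<otimes> b) H"
      using ab(1,2) by (intro inj_onI) (simp add: H.mem_carrier)
    have act: "diagonal_action (G Mod N) (N #> h) g = N #> (inv a \<otimes> h \<otimes> b)" if "h \<in> H" for h
    proof -
      have "inv\<^bsub>G Mod N\<^esub> (N #> a) = N #> inv a"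
        using N.inv_FactGroup[of "N #> a"] N.rcos_inv[of a] ab carQ by auto
      then show ?thesis using ab that H.mem_carrier[OF that]
        by (simp add: diagonal_action_def FactGroup_def N.rcos_sum)
    qed
    have img: "(\<lambda>\<beta>. diagonal_action (G Mod N) \<beta> g) ` B = (#>) N ` S"
      using act unfolding B_def S_def image_image by (intro image_cong) auto
    have SQ: "(#>) N ` S \<subseteq> carrier (G Mod N)" using S by (auto simp: carQ)
    have "entry_sum (carrier (G Mod N)) (schur (count A) (indicator ((#>) N ` S)))
        = (\<Sum>C\<in>(#>) N ` S. w C)"
    proof -
      have "entry_sum (carrier (G Mod N)) (schur (count A) (indicator ((#>) N ` S)))
        = (\<Sum>C\<in>carrier (G Mod N). if C \<in> (#>) N ` S then w C else 0)"
        unfolding entry_sum_def schur_def countA by (rule sum.cong) (auto simp: indicator_def)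
      also have "\<dots> = (\<Sum>C\<in>carrier (G Mod N) \<inter> (#>) N ` S. w C)"
        using finQ by (simp add: sum.inter_restrict)
      finally show ?thesis using SQ by (simp add: Int_absorb1)
    qed
    then have "card N * entry_sum (carrier (G Mod N)) (schur (count A) (indicator ((#>) N ` S)))
        = (\<Sum>s\<in>S. f s)"
      using sumQ[OF S Sclosed] by simp
    also have "\<dots> = (\<Sum>h\<in>H. f (inv a \<otimes> h \<otimes> b))"
      unfolding S_def by (simp add: sum.reindex[OF inj])
    \<comment> \<open>The class function property carries \<open>inv a\<close> around to the right
      end.\<close>
    also have "\<dots> = (\<Sum>h\<in>H. f (h \<otimes> (b \<otimes> inv a)))"
    proof (rule sum.cong[OF refl])
      fix h assume "h \<in> H"
      then have h: "h \<in> carrier G" by (rule H.mem_carrier)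
      show "f (inv a \<otimes> h \<otimes> b) = f (h \<otimes> (b \<otimes> inv a))"
        using central[of "inv a" "h \<otimes> b"] ab h by (simp add: m_assoc)
    qed
    also have "\<dots> = card H" using ab by (simp add: average)
    finally show ?thesis unfolding img .
  qed
  \<comment> \<open>The division is exact: \<open>slice\<close> exhibits \<open>card H\<close> as a
    multiple of \<open>card N\<close>.\<close>
  define l where "l = card H div card N"
  have slice': "entry_sum (carrier (G Mod N))
      (schur (count A) (indicator ((\<lambda>\<beta>. diagonal_action (G Mod N) \<beta> g) ` B))) = l"
    if "g \<in> carrier ((G Mod N) \<times>\<times> (G Mod N))" for g
    using slice[OF that] finN unfolding l_def by (metis nonzero_mult_div_cancel_left less_numeral_extra(3))
  have lpos: "l > 0"
    using finN H(2) finH unfolding l_def by (simp add: card_mono div_greater_zero_iff)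
  have two: "card {\<alpha> \<in> carrier (G Mod N). v \<alpha> \<noteq> 0} > 1"
    if "C \<in> carrier (G Mod N)" "D \<in> carrier (G Mod N)" "C \<noteq> D" "v C \<noteq> 0" "v D \<noteq> 0"
    for C D and v :: "'a set \<Rightarrow> nat"
  proof -
    have "card {C, D} \<le> card {\<alpha> \<in> carrier (G Mod N). v \<alpha> \<noteq> 0}"
      using that finQ by (intro card_mono) auto
    then show ?thesis using that by simp
  qed
  have distinct: "N #> \<one> \<noteq> N #> u" if "u \<in> carrier G" "u \<notin> N" for u
    using coset_eq[of u \<one>] that by auto
  have inQ: "N #> u \<in> carrier (G Mod N)" if "u \<in> carrier G" for u using that carQ by auto
  have ntA: "nontrivial (carrier (G Mod N)) (count A)"
    unfolding nontrivial_def
  proof (intro conjI notI)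
    assume "\<exists>c. \<forall>\<alpha>\<in>carrier (G Mod N). count A \<alpha> = c"
    then have "count A (N #> \<one>) = count A (N #> x)" using inQ zero by auto
    then show False using zero one inQ by (simp add: countA w)
  qed (rule two[of "N #> \<one>" "N #> y"], use one other inQ distinct in \<open>auto simp: countA w\<close>)
  \<comment> \<open>For \<open>B\<close>, the coset of \<open>k\<close> gives the value 0, while
    those of \<open>\<one>\<close> and \<open>h\<close> are two distinct members.\<close>
  obtain k where k: "k \<in> carrier G" "k \<notin> H" using H(3) H.subset by blast
  obtain h where h: "h \<in> H" "h \<notin> N" using H(2,4) by blast
  have hc: "h \<in> carrier G" using h by (simp add: H.mem_carrier)
  have ntB: "nontrivial (carrier (G Mod N)) (indicator B)"
    unfolding nontrivial_def
  proof (intro conjI notI)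
    assume "\<exists>c. \<forall>\<alpha>\<in>carrier (G Mod N). indicator B \<alpha> = (c::nat)"
    then have "indicator B (N #> \<one>) = (indicator B (N #> k) :: nat)" using inQ k by auto
    then show False using k memB[of k] memB[of \<one>] by (simp add: indicator_def)
  qed (rule two[of "N #> \<one>" "N #> h"],
      use h hc inQ distinct memB[of h] memB[of \<one>] in \<open>auto simp: indicator_def\<close>)
  have "set_mset A \<subseteq> carrier (G Mod N)"
    by (auto simp: set_mset_def countA split: if_splits)
  with ntA ntB BQ lpos slice' totalQ finQ show ?thesis
    unfolding non_spreading_def
    by (intro conjI transitive_right_action_diagonal Q.is_group exI[of _ A] exI[of _ B] exI[of _ l])
      auto
qed

text \<open>If some \<open>h\<close> qualifies, then \<open>g = inv h (h g)\<close> lies in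
  \<open>H\<close>; conversely, for \<open>g\<close> in \<open>H\<close>, right multiplication by
  \<open>g\<close> matches the qualifying \<open>h\<close> with \<open>N\<close>. It counts the
  scalars in a translate of the Borel subgroup.\<close>

lemma (in group) card_translate_into_subgroup:
  assumes "subgroup H G" "subgroup N G" "N \<subseteq> H" "g \<in> carrier G"
  shows "card {h \<in> H. h \<otimes> g \<in> N} = (if g \<in> H then card N else 0)"
proof -
  interpret H: subgroup H G by fact
  interpret N: subgroup N G by fact
  have g: "g \<in> H" if "h \<in> H" "h \<otimes> g \<in> N" for h
  proof -
    have "inv h \<otimes> (h \<otimes> g) \<in> H" using that assms(3) by blast
    then show ?thesis using that assms(4) by (simp flip: m_assoc)
  qed
  have "bij_betw (\<lambda>h. h \<otimes> g) {h \<in> H. h \<otimes> g \<in> N} N" if "g \<in> H"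
    using that assms(3)
    by (intro bij_betw_byWitness[where f' = "\<lambda>n. n \<otimes> inv g"]) (auto simp: m_assoc subset_iff)
  moreover have "{h \<in> H. h \<otimes> g \<in> N} = {}" if "g \<notin> H" using that g by blast
  ultimately show ?thesis by (cases "g \<in> H") (metis bij_betw_same_card, metis card.empty)
qed

section \<open>Two-by-two matrices and the Borel subgroup\<close>

definition mat2 :: "'k::field \<Rightarrow> 'k \<Rightarrow> 'k \<Rightarrow> 'k \<Rightarrow> 'k ^ 2 ^ 2" where
  "mat2 a b c d = vector [vector [a, b], vector [c, d]]"

lemma mat2_nth [simp]:
  "mat2 a b c d $ 1 $ 1 = a" "mat2 a b c d $ 1 $ 2 = b"
  "mat2 a b c d $ 2 $ 1 = c" "mat2 a b c d $ 2 $ 2 = d"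
  by (simp_all add: mat2_def)

lemma mat2_eq_iff: "M = N \<longleftrightarrow>
    M$1$1 = N$1$1 \<and> M$1$2 = N$1$2 \<and> M$2$1 = N$2$1 \<and> M$2$2 = N$2$2"
  for M N :: "'k::field ^ 2 ^ 2"
  by (auto simp: vec_eq_iff forall_2)

lemma mult_nth_2: "(M ** N) $ i $ j = M $ i $ 1 * N $ 1 $ j + M $ i $ 2 * N $ 2 $ j"
  for M N :: "'k::field ^ 2 ^ 2"
  by (simp add: matrix_matrix_mult_def sum_2)

lemma trace_2: "trace M = M $ 1 $ 1 + M $ 2 $ 2" for M :: "'k::field ^ 2 ^ 2"
  by (simp add: trace_def sum_2)

lemma SL_scalars_2: "(SL_scalars :: ('k::field ^ 2 ^ 2) set) = mat ` {1, -1}"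
proof -
  have "det (mat c :: 'k^2^2) = 1 \<longleftrightarrow> c = 1 \<or> c = -1" for c :: 'k
    using power2_eq_1_iff[of c] by (simp add: det_2 mat_def power2_eq_square)
  then show ?thesis unfolding SL_scalars_def by auto
qed

text \<open>Keeping the value as \<open>card {1, -1}\<close> treats even and odd characteristic
  together.\<close>

lemma card_SL_scalars_2: "card (SL_scalars :: ('k::field ^ 2 ^ 2) set) = card {1, -1 :: 'k}"
  unfolding SL_scalars_2 by (rule card_image) (auto intro!: inj_onI simp: mat2_eq_iff mat_def)

definition borel_SL :: "('k::field ^ 2 ^ 2) set" where
  "borel_SL = {M. det M = 1 \<and> M $ 2 $ 1 = 0}"

lemma subgroup_borel_SL: "subgroup (borel_SL :: ('k::field ^ 2 ^ 2) set) SL"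
proof -
  interpret group "SL :: ('k ^ 2 ^ 2) monoid" by (rule group_SL)
  show ?thesis
  proof (rule subgroupI)
    fix M :: "'k ^ 2 ^ 2" assume M: "M \<in> borel_SL"
    \<comment> \<open>The adjugate of \<open>M\<close>, which is its inverse since
      \<open>det M = 1\<close>.\<close>
    define N where "N = mat2 (M$2$2) (- M$1$2) 0 (M$1$1)"
    have "N ** M = mat 1" "det N = 1"
      using M by (auto simp: N_def borel_SL_def mat2_eq_iff mult_nth_2 det_2 mat_def mult.commute)
    then have "inv\<^bsub>SL\<^esub> M = N" using M by (intro inv_equality) (auto simp: SL_def borel_SL_def)
    then show "inv\<^bsub>SL\<^esub> M \<in> borel_SL" using \<open>det N = 1\<close> by (simp add: borel_SL_def N_def)
  next
    have "mat 1 \<in> (borel_SL :: ('k ^ 2 ^ 2) set)" by (simp add: borel_SL_def mat_def det_2)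
    then show "borel_SL \<noteq> ({} :: ('k ^ 2 ^ 2) set)" by blast
  qed (auto simp: borel_SL_def SL_def det_mul mult_nth_2)
qed

lemma borel_SL_bij:
  "bij_betw (\<lambda>(a, b). mat2 a b 0 (inverse a)) ((UNIV - {0}) \<times> UNIV) (borel_SL :: ('k::field ^ 2 ^ 2) set)"
proof (rule bij_betw_byWitness[where f' = "\<lambda>M. (M$1$1, M$1$2)"])
  show "\<forall>M\<in>borel_SL. (case (M$1$1, M$1$2) of (a, b) \<Rightarrow> mat2 a b 0 (inverse a)) = (M :: 'k^2^2)"
    by (auto simp: borel_SL_def det_2 mat2_eq_iff inverse_unique)
qed (auto simp: borel_SL_def det_2)

text \<open>With \<open>b\<close> now the upper right entry of the Borel element, the trace is
  \<open>a * g$1$1 + b * g$2$1 + inverse a * g$2$2\<close>. If \<open>g$2$1\<close> is nonzero, this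
  runs once through the field as \<open>b\<close> varies, for each of the \<open>q - 1\<close>
  values of \<open>a\<close>. Otherwise it is independent of \<open>b\<close>, and
  \<open>g$2$2\<close> is the inverse of \<open>g$1$1\<close>, so rescaling \<open>a\<close> removes
  \<open>g\<close>.\<close>

lemma sum_trace_borel:
  fixes g :: "'k::{field,finite} ^ 2 ^ 2" and \<phi> :: "'k \<Rightarrow> int"
  assumes "det g = 1"
  shows "(\<Sum>b\<in>borel_SL. \<phi> (trace (b ** g))) =
    (if g $ 2 $ 1 = 0 then int CARD('k) * (\<Sum>a\<in>UNIV - {0}. \<phi> (a + inverse a))
     else (int CARD('k) - 1) * (\<Sum>s\<in>UNIV. \<phi> s))"
proof -
  have "(\<Sum>b\<in>borel_SL. \<phi> (trace (b ** g)))
      = (\<Sum>(a, b)\<in>(UNIV - {0}) \<times> UNIV. \<phi> (a * g$1$1 + b * g$2$1 + inverse a * g$2$2))"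
    by (subst sum.reindex_bij_betw[OF borel_SL_bij, symmetric])
      (simp add: trace_2 mult_nth_2 case_prod_unfold)
  also have "\<dots> = (\<Sum>a\<in>UNIV - {0}. \<Sum>b\<in>UNIV. \<phi> (a * g$1$1 + b * g$2$1 + inverse a * g$2$2))"
    by (simp add: sum.cartesian_product)
  finally have *: "(\<Sum>b\<in>borel_SL. \<phi> (trace (b ** g))) = \<dots>" .
  show ?thesis
  proof (cases "g $ 2 $ 1 = 0")
    case True
    then have d: "g$1$1 * g$2$2 = 1" using assms by (simp add: det_2)
    then have g: "g$1$1 \<noteq> 0" "g$2$2 = inverse (g$1$1)" by (auto simp: inverse_unique)
    have "(\<Sum>a\<in>UNIV - {0}. \<phi> (a * g$1$1 + inverse a * g$2$2)) = (\<Sum>a\<in>UNIV - {0}. \<phi> (a + inverse a))"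
      using g by (intro sum.reindex_bij_witness[where i = "\<lambda>a. a / g$1$1" and j = "\<lambda>a. a * g$1$1"])
        (auto simp: mult.commute)
    then show ?thesis unfolding * using True by (simp flip: sum_distrib_left)
  next
    case False
    have "(\<Sum>b\<in>UNIV. \<phi> (x + b * g$2$1 + y)) = (\<Sum>s\<in>UNIV. \<phi> s)" for x y
      using False
      by (intro sum.reindex_bij_witness[where i = "\<lambda>s. (s - x - y) / g$2$1" and j = "\<lambda>b. x + b * g$2$1 + y"])
        auto
    moreover have "int (card (UNIV - {0 :: 'k})) = int CARD('k) - 1"
      by (simp add: card_Diff_subset of_nat_diff)
    ultimately show ?thesis unfolding * using False by simp
  qed
qed

section \<open>The weight on traces\<close>

text \<open>Only \<open>q - 1\<close> values of \<open>a\<close> are available. Such a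
  \<open>t\<close> is one for which \<open>x^2 - t x + 1\<close> has no root in the field.\<close>

lemma exists_nonsplit_trace: "\<exists>t :: 'k::{field,finite}. \<forall>a. a \<noteq> 0 \<longrightarrow> t \<noteq> a + inverse a"
proof -
  have "card ((\<lambda>a. a + inverse a) ` (UNIV - {0 :: 'k})) \<le> card (UNIV - {0 :: 'k})"
    by (rule card_image_le) simp
  also have "\<dots> < CARD('k)" by (rule psubset_card_mono) auto
  finally have "(\<lambda>a. a + inverse a) ` (UNIV - {0 :: 'k}) \<noteq> UNIV" by auto
  then show ?thesis by blast
qed

lemma sum_of_bool_mem: "finite A \<Longrightarrow> (\<Sum>x\<in>A. of_bool (x \<in> P)) = int (card (A \<inter> P))"
  by (simp add: of_bool_def sum.If_cases)

text \<open>The positive mass sits on \<plusminus>t, which no \<open>a + inverse a\<close> meets, so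
  the sum over \<open>a\<close> sees only the value -1 at \<plusminus>2, attained exactly for
  \<open>a\<close> = \<plusminus>1.\<close>

lemma balanced_trace_weight:
  fixes t :: "'k::{field,finite}"
  assumes t: "\<And>a. a \<noteq> 0 \<Longrightarrow> t \<noteq> a + inverse a"
  obtains \<phi> :: "'k \<Rightarrow> int" where
    "(\<Sum>s\<in>UNIV. \<phi> s) = 0"
    "(\<Sum>a\<in>UNIV - {0}. \<phi> (a + inverse a)) = - int (card {1, -1 :: 'k})"
    "\<And>s. \<phi> (- s) = \<phi> s" "\<And>s. \<phi> s \<ge> -1" "\<phi> 2 = -1" "\<phi> t \<ge> 0"
proof -
  \<comment> \<open>\<open>c\<close> compensates for \<open>t = -t\<close> when \<open>2 \<noteq> -2\<close>.\<close>
  define c :: nat where "c = (if t = 0 \<and> (2::'k) \<noteq> 0 then 2 else 1)"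
  define \<phi> :: "'k \<Rightarrow> int" where
    "\<phi> s = int c * of_bool (s \<in> {t, -t}) - of_bool (s \<in> {2, -2})" for s
  \<comment> \<open>The case \<open>2 = 0\<close> is characteristic 2, where both pairs
    \<plusminus>t and \<plusminus>2 collapse to single points.\<close>
  have neg: "-x = x \<longleftrightarrow> x = 0 \<or> (2::'k) = 0" for x :: 'k
    using mult_eq_0_iff[of 2 x] by (auto simp: neg_eq_iff_add_eq_0 simp flip: mult_2)
  have t': "t \<noteq> 2" "t \<noteq> -2" using t[of 1] t[of "-1"] by auto
  have disj: "2 \<notin> {t, -t}" "t \<notin> {2, -2}" using t' minus_equation_iff[of t 2] by auto
  have card: "c * card {t, -t} = card {2, -2 :: 'k}"
    using neg[of t] neg[of 2] t' by (auto simp: c_def card_insert_if)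
  show ?thesis
  proof
    show "(\<Sum>s\<in>UNIV. \<phi> s) = 0"
      using card by (simp add: \<phi>_def sum_subtractf sum_of_bool_mem
          del: insert_iff flip: sum_distrib_left of_nat_mult)
    have "a + inverse a \<notin> {t, -t}" if "a \<noteq> 0" for a
      using t[of a] t[of "-a"] that by (auto simp: equation_minus_iff[of "a + inverse a"])
    moreover have "a + inverse a \<in> {2, -2} \<longleftrightarrow> a \<in> {1, -1}" if "a \<noteq> 0" for a :: 'k
    proof -
      \<comment> \<open>The perfect squares show that 1 and -1 are the only solutions for the traces
        2 and -2.\<close>
      have factor: "a * (a + inverse a - 2) = (a - 1)\<^sup>2" "a * (a + inverse a + 2) = (a + 1)\<^sup>2"
        using that by (simp_all add: algebra_simps power2_eq_square)
      have "a + inverse a = 2 \<longleftrightarrow> a * (a + inverse a - 2) = 0" using that by simp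
      moreover have "a + inverse a = -2 \<longleftrightarrow> a * (a + inverse a + 2) = 0"
        using that by (simp add: eq_neg_iff_add_eq_0)
      ultimately show ?thesis unfolding factor by (simp add: eq_neg_iff_add_eq_0)
    qed
    ultimately have "(\<Sum>a\<in>UNIV - {0}. \<phi> (a + inverse a)) = (\<Sum>a\<in>UNIV - {0}. - of_bool (a \<in> {1, -1 :: 'k}))"
      by (intro sum.cong[OF refl]) (simp only: \<phi>_def Diff_iff singleton_iff of_bool_eq, simp)
    also have "\<dots> = - int (card ((UNIV - {0}) \<inter> {1, -1 :: 'k}))"
      by (simp add: sum_negf sum_of_bool_mem del: insert_iff)
    also have "(UNIV - {0}) \<inter> {1, -1 :: 'k} = {1, -1}" by auto
    finally show "(\<Sum>a\<in>UNIV - {0}. \<phi> (a + inverse a)) = - int (card {1, -1 :: 'k})" .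
    show "\<phi> (- s) = \<phi> s" for s
    proof -
      have "- s \<in> {x, - x} \<longleftrightarrow> s \<in> {x, - x}" for x
        using minus_equation_iff[of s x] by auto
      then show ?thesis by (simp only: \<phi>_def)
    qed
    show "\<phi> s \<ge> -1" for s by (auto simp: \<phi>_def)
    show "\<phi> 2 = -1" using disj by (simp add: \<phi>_def)
    show "\<phi> t \<ge> 0" using disj by (simp add: \<phi>_def)
  qed
qed

theorem theorem1p2:
  fixes q :: nat
    and T :: "('k::{field,finite} ^ 2 ^ 2) set monoid"
  assumes "primepow q"
    and "CARD('k) = q"
    and "T = PSL"
  shows "non_spreading (T \<times>\<times> T) (carrier T) (diagonal_action T)"
proof -
  obtain t :: 'k where t: "\<And>a. a \<noteq> 0 \<Longrightarrow> t \<noteq> a + inverse a"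
    using exists_nonsplit_trace by blast
  obtain \<phi> :: "'k \<Rightarrow> int" where \<phi>:
    "(\<Sum>s\<in>UNIV. \<phi> s) = 0"
    "(\<Sum>a\<in>UNIV - {0}. \<phi> (a + inverse a)) = - int (card {1, -1 :: 'k})"
    "\<And>s. \<phi> (- s) = \<phi> s" "\<And>s. \<phi> s \<ge> -1" "\<phi> 2 = -1" "\<phi> t \<ge> 0"
    using balanced_trace_weight[OF t] by metis
  interpret SL: group "SL :: ('k ^ 2 ^ 2) monoid" by (rule group_SL)
  let ?Z = "SL_scalars :: ('k ^ 2 ^ 2) set"
  let ?B = "borel_SL :: ('k ^ 2 ^ 2) set"
  interpret Z: normal ?Z "SL :: ('k ^ 2 ^ 2) monoid" by (rule normal_SL_scalars)
  have ZB: "?Z \<subseteq> ?B" by (auto simp: SL_scalars_def borel_SL_def mat_def)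
  \<comment> \<open>\<open>nat\<close> truncates nothing, because \<open>\<phi>\<close> is at least
    -1.\<close>
  define f :: "'k ^ 2 ^ 2 \<Rightarrow> nat" where
    "f M = nat (1 + \<phi> (trace M) + int q * of_bool (M \<in> ?Z))" for M
  have f: "int (f M) = 1 + \<phi> (trace M) + int q * of_bool (M \<in> ?Z)" for M
    using \<phi>(4)[of "trace M"] by (simp add: f_def)
  have q: "q > 0" using assms(2) by auto
  have Z_iff: "mat2 a b c d \<in> ?Z \<longleftrightarrow> b = 0 \<and> c = 0 \<and> a = d \<and> (a = 1 \<or> a = -1)" for a b c d
    by (auto simp: SL_scalars_2 mat2_eq_iff mat_def)
  have SL_mult: "x \<otimes>\<^bsub>SL\<^esub> y = x ** y" for x y :: "'k ^ 2 ^ 2" by (simp add: SL_def)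
  have "non_spreading ((SL Mod ?Z) \<times>\<times> (SL Mod ?Z)) (carrier (SL Mod ?Z)) (diagonal_action (SL Mod ?Z))"
  \<comment> \<open>The nonscalar unipotent \<open>x\<close> has trace 2, where
    \<open>\<phi>\<close> cancels the constant 1. The companion matrix \<open>y\<close> has trace
    \<open>t\<close>, where the weight is positive.\<close>
  proof (rule SL.non_spreading_diagonal_Mod[where H = ?B and f = f
        and x = "mat2 1 1 0 1" and y = "mat2 t (-1) 1 0"])
    show "?Z \<lhd> SL" by (rule normal_SL_scalars)
    show "subgroup ?B SL" by (rule subgroup_borel_SL)
    have "mat2 0 (-1) 1 0 \<in> carrier (SL :: ('k ^ 2 ^ 2) monoid) - ?B"
      by (simp add: SL_def borel_SL_def det_2)
    then show "?B \<noteq> carrier SL" by blast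
    have "mat2 1 1 0 1 \<in> ?B - ?Z" by (simp add: borel_SL_def det_2 Z_iff)
    then show "?B \<noteq> ?Z" by blast
    show "f (x \<otimes>\<^bsub>SL\<^esub> y) = f (y \<otimes>\<^bsub>SL\<^esub> x)" if "x \<in> carrier SL" "y \<in> carrier SL" for x y
    proof -
      \<comment> \<open>Conjugating \<open>x y\<close> by \<open>y\<close> gives \<open>y x\<close>,
        and the scalars form a normal subgroup.\<close>
      have comm: "y \<otimes>\<^bsub>SL\<^esub> x \<in> ?Z" if "x \<otimes>\<^bsub>SL\<^esub> y \<in> ?Z" "x \<in> carrier SL" "y \<in> carrier SL" for x y
        using Z.inv_op_closed2[of y "x \<otimes>\<^bsub>SL\<^esub> y"] that by (simp add: SL.m_assoc)
      have "x \<otimes>\<^bsub>SL\<^esub> y \<in> ?Z \<longleftrightarrow> y \<otimes>\<^bsub>SL\<^esub> x \<in> ?Z"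
        using comm that by blast
      then show ?thesis unfolding f_def by (simp add: SL_mult trace_mul_sym[of x y])
    qed
    show "f (n \<otimes>\<^bsub>SL\<^esub> x) = f x" if n: "n \<in> ?Z" and x: "x \<in> carrier SL" for n x
    proof -
      have "n \<otimes>\<^bsub>SL\<^esub> x \<in> ?Z \<longleftrightarrow> x \<in> ?Z"
      proof
        assume "n \<otimes>\<^bsub>SL\<^esub> x \<in> ?Z"
        then have "inv\<^bsub>SL\<^esub> n \<otimes>\<^bsub>SL\<^esub> (n \<otimes>\<^bsub>SL\<^esub> x) \<in> ?Z" using n by blast
        then show "x \<in> ?Z" using n x by (simp flip: SL.m_assoc)
      qed (use n in blast)
      moreover have "\<phi> (trace (n ** x)) = \<phi> (trace x)"
        using n \<phi>(3)[of "trace x"]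
        by (auto simp: SL_scalars_2 trace_2 mult_nth_2 mat_def)
      ultimately show ?thesis by (simp add: f_def SL_mult)
    qed
    show "(\<Sum>h\<in>?B. f (h \<otimes>\<^bsub>SL\<^esub> g)) = card ?B" if g: "g \<in> carrier SL" for g
    proof -
      have "det g = 1" using g by (simp add: SL_def)
      have "(\<Sum>h\<in>?B. of_bool (h ** g \<in> ?Z)) = int (card {h \<in> ?B. h ** g \<in> ?Z})"
        by (simp add: of_bool_def sum.If_cases Collect_conj_eq)
      also have "\<dots> = (if g $ 2 $ 1 = 0 then int (card {1, -1 :: 'k}) else 0)"
        using SL.card_translate_into_subgroup[OF subgroup_borel_SL Z.subgroup_axioms ZB g] \<open>det g = 1\<close>
        by (simp add: SL_mult borel_SL_def card_SL_scalars_2)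
      \<comment> \<open>For upper triangular \<open>g\<close> the scalars contribute
        \<open>q * card {1, -1}\<close>, exactly cancelling the sum of \<open>\<phi>\<close>; for
        other \<open>g\<close> both terms vanish. The constant 1 leaves
        \<open>card ?B\<close>.\<close>
      finally have "int (\<Sum>h\<in>?B. f (h \<otimes>\<^bsub>SL\<^esub> g)) = int (card ?B)"
        using sum_trace_borel[OF \<open>det g = 1\<close>, of \<phi>] \<phi>(1,2) assms(2)
        by (simp add: SL_mult f sum.distrib flip: sum_distrib_left)
      then show ?thesis by (simp only: of_nat_eq_iff)
    qed
    show "f (mat2 1 1 0 1) = 0" using \<phi>(5) by (simp add: f_def trace_2 Z_iff)
    have "mat 1 \<in> ?Z" by (simp add: SL_scalars_2)
    then have "int (f (mat 1)) \<noteq> 0" using f[of "mat 1"] \<phi>(4)[of "trace (mat 1 :: 'k^2^2)"] q by simp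
    then show "f \<one>\<^bsub>SL\<^esub> \<noteq> 0" by (simp add: SL_def)
    have "int (f (mat2 t (-1) 1 0)) \<noteq> 0"
      using \<phi>(6) by (simp add: f trace_2 Z_iff)
    then show "f (mat2 t (-1) 1 0) \<noteq> 0" by simp
  qed (use ZB in \<open>auto simp: SL_def det_2 Z_iff\<close>)
  then show ?thesis by (simp add: assms(3) PSL_def)
qed

end
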